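(* There exist absolute constants $C>0$ and $d_0\geq 3$ such that the following holds. Let $D(t)\in\mathbb{Q}[t]$ be a nonconstant Pellian polynomial with fundamental solution $(u(t),v(t))$, $u,v\in\mathbb{Q}[t]$, and let $d=\deg u\geq d_0$. If $n\geq 1$ is an integer such that $v^{\mathrm{new}}_n(t)$ has a repeated root in $\mathbb{C}$, then $n\leq C\, d\log\log d$.
   Context: Pell's equation for a nonconstant $D$ is $x^2-Dy^2=1$ with $x,y\in\mathbb{C}[t]$. $D$ is called Pellian if it has a solution with $y\neq0$. A fundamental solution is a solution $(u,v)$ with $v\neq 0$ of minimal degree among all solutions with $y\neq0$. For integers $n\geq 1$ define $u_n,v_n$ by $u_n+v_n\sqrt{D}=(u+v\sqrt{D})^n$. The "new part" $v^{\mathrm{new}}_n$ of $v_n$ is the polynomial determined by $v_n=\prod_{m\mid n}v^{\mathrm{new}}_m$ for all $n\geq 1$; equivalently $v^{\mathrm{new}}_n=\prod_{m\mid n}v_m^{\mu(n/m)}$, where $\mu$ is the Möbius function. *)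

theory Defs
  imports
    Complex_Main
    "HOL-Computational_Algebra.Computational_Algebra"
    "HOL-Number_Theory.Totient"
begin

text \<open>The inclusion of \<open>\<rat>[t]\<close> in \<open>\<complex>[t]\<close>.\<close>

abbreviation cpoly :: "rat poly \<Rightarrow> complex poly" where
  "cpoly \<equiv> map_poly of_rat"

definition pell_solution :: "complex poly \<Rightarrow> complex poly \<Rightarrow> complex poly \<Rightarrow> bool" where
  "pell_solution D x y \<longleftrightarrow> x\<^sup>2 - D * y\<^sup>2 = 1"

definition pellian :: "complex poly \<Rightarrow> bool" where
  "pellian D \<longleftrightarrow> (\<exists>x y. pell_solution D x y \<and> y \<noteq> 0)"

text \<open>The degree of a solution \<open>(x, y)\<close> is the degree of \<open>x\<close>.  For nonconstant \<open>D\<close> and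
  \<open>y \<noteq> 0\<close> we have \<open>2 * degree x = degree D + 2 * degree y\<close>, so minimising the degree of \<open>y\<close>
  would give the same notion.\<close>

definition pell_fundamental :: "complex poly \<Rightarrow> complex poly \<Rightarrow> complex poly \<Rightarrow> bool" where
  "pell_fundamental D u v \<longleftrightarrow> pell_solution D u v \<and> v \<noteq> 0 \<and>
     (\<forall>x y. pell_solution D x y \<and> y \<noteq> 0 \<longrightarrow> degree u \<le> degree x)"

text \<open>A pair \<open>(a, b)\<close> stands for \<open>a + b * \<surd>D\<close>; \<open>pell_mult D\<close> is the multiplication of such
  elements and \<open>pell_power D u v n\<close> is \<open>(u\<^sub>n, v\<^sub>n)\<close>, i.e. \<open>(u + v * \<surd>D)\<^sup>n\<close>.\<close>

fun pell_mult :: "'a::comm_ring_1 \<Rightarrow> 'a \<times> 'a \<Rightarrow> 'a \<times> 'a \<Rightarrow> 'a \<times> 'a" where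
  "pell_mult D (a, b) (c, e) = (a * c + D * b * e, a * e + b * c)"

primrec pell_power :: "'a::comm_ring_1 \<Rightarrow> 'a \<Rightarrow> 'a \<Rightarrow> nat \<Rightarrow> 'a \<times> 'a" where
  "pell_power D u v 0 = (1, 0)"
| "pell_power D u v (Suc n) = pell_mult D (u, v) (pell_power D u v n)"

definition pell_u :: "'a::comm_ring_1 \<Rightarrow> 'a \<Rightarrow> 'a \<Rightarrow> nat \<Rightarrow> 'a" where
  "pell_u D u v n = fst (pell_power D u v n)"

definition pell_v :: "'a::comm_ring_1 \<Rightarrow> 'a \<Rightarrow> 'a \<Rightarrow> nat \<Rightarrow> 'a" where
  "pell_v D u v n = snd (pell_power D u v n)"

lemma pell_u_simps:
  "pell_u D u v 0 = 1"
  "pell_u D u v (Suc n) = u * pell_u D u v n + D * v * pell_v D u v n"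
  by (cases "pell_power D u v n"; simp add: pell_u_def pell_v_def)+

lemma pell_v_simps:
  "pell_v D u v 0 = 0"
  "pell_v D u v (Suc n) = u * pell_v D u v n + v * pell_u D u v n"
  by (cases "pell_power D u v n"; simp add: pell_u_def pell_v_def)+

text \<open>The defining identity \<open>u\<^sub>n + v\<^sub>n * \<surd>D = (u + v * \<surd>D)\<^sup>n\<close>, in the ring of
  polynomials in a variable \<open>X\<close> modulo \<open>X\<^sup>2 - D\<close>.\<close>

lemma pell_u_v_power:
  "[:- D, 0, 1:] dvd [:u, v:] ^ n - [:pell_u D u v n, pell_v D u v n:]"
proof (induction n)
  case 0
  show ?case by (simp add: one_pCons pell_u_simps pell_v_simps)
next
  case (Suc n)
  have "[:u, v:] ^ Suc n - [:pell_u D u v (Suc n), pell_v D u v (Suc n):] =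
        [:u, v:] * ([:u, v:] ^ n - [:pell_u D u v n, pell_v D u v n:]) +
        [:- D, 0, 1:] * [:v * pell_v D u v n:]"
    by (simp add: pell_u_simps pell_v_simps algebra_simps)
  then show ?case
    using Suc.IH by (metis dvd_add dvd_mult dvd_triv_left)
qed

text \<open>The family \<open>w n\<close> (\<open>n \<ge> 1\<close>) of new parts of the \<open>v\<^sub>n\<close>.  If \<open>D\<close> is nonconstant and
  \<open>v \<noteq> 0\<close>, no \<open>v\<^sub>n\<close> with \<open>n \<ge> 1\<close> vanishes, so the product formula determines \<open>w n\<close>
  for \<open>n \<ge> 1\<close> and forces it to be nonzero; \<open>w 0\<close> is unconstrained and never used.\<close>

definition pell_new_parts ::
    "complex poly \<Rightarrow> complex poly \<Rightarrow> complex poly \<Rightarrow> (nat \<Rightarrow> complex poly) \<Rightarrow> bool" where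
  "pell_new_parts D u v w \<longleftrightarrow> (\<forall>n\<ge>1. pell_v D u v n = (\<Prod>m | m dvd n. w m))"

text \<open>Existence of the new parts: \<open>v\<^sub>n\<close> is \<open>v\<close> times the Chebyshev polynomial of the second
  kind \<open>U\<^bsub>n-1\<^esub>\<close> evaluated at \<open>u\<close>, whose roots are the \<open>cos (k * pi / n)\<close>; those with \<open>k\<close>
  coprime to \<open>n\<close> give the new part.\<close>

fun cheb :: "nat \<Rightarrow> complex poly" where
  "cheb 0 = 0"
| "cheb (Suc 0) = 1"
| "cheb (Suc (Suc n)) = [:0, 2:] * cheb (Suc n) - cheb n"

lemma pell_v_cheb:
  assumes "pell_solution D u v"
  shows "pell_v D u v n = v * pcompose (cheb n) u"
proof (induction n rule: cheb.induct)
  case 1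
  show ?case by (simp add: pell_v_simps)
next
  case 2
  show ?case by (simp add: pell_u_simps pell_v_simps pcompose_1)
next
  case (3 n)
  have "pell_v D u v (Suc (Suc n)) =
        2 * u * pell_v D u v (Suc n) - (u\<^sup>2 - D * v\<^sup>2) * pell_v D u v n"
    by (simp add: pell_u_simps pell_v_simps algebra_simps power2_eq_square)
  also have "u\<^sup>2 - D * v\<^sup>2 = 1"
    using assms by (simp add: pell_solution_def)
  finally show ?case
    using 3 by (simp add: pcompose_diff pcompose_mult pcompose_pCons pcompose_smult numeral_poly
        algebra_simps)
qed

lemma poly_cheb_cos: "poly (cheb n) (of_real (cos x)) * of_real (sin x) = of_real (sin (real n * x))"
proof (induction n rule: cheb.induct)
  case (3 n)
  have "poly (cheb (Suc (Suc n))) (of_real (cos x)) * of_real (sin x) =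
        (of_real (2 * cos x * sin (real (Suc n) * x) - sin (real n * x)) :: complex)"
    using 3 by (simp add: algebra_simps)
  also have "2 * cos x * sin (real (Suc n) * x) - sin (real n * x) = sin (real (Suc (Suc n)) * x)"
  proof -
    have "real n * x = real (Suc n) * x - x" "real (Suc (Suc n)) * x = real (Suc n) * x + x"
      by (simp_all add: algebra_simps)
    then show ?thesis
      by (simp only: sin_add sin_diff) (simp add: algebra_simps)
  qed
  finally show ?case .
qed auto

lemma cheb_degree: "degree (cheb (Suc n)) \<le> n \<and> coeff (cheb (Suc n)) n = 2 ^ n"
proof (induction n rule: less_induct)
  case (less n)
  consider "n = 0" | "n = 1" | m where "n = Suc (Suc m)"
    by (metis One_nat_def not0_implies_Suc)
  then show ?case
  proof cases
    case 3
    have d: "degree (cheb (Suc m)) \<le> m" "degree (cheb (Suc (Suc m))) \<le> Suc m"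
      "coeff (cheb (Suc (Suc m))) (Suc m) = 2 ^ Suc m"
      using less[of m] less[of "Suc m"] 3 by auto
    then show ?thesis
      unfolding 3 by (auto simp: coeff_pCons coeff_eq_0 intro!: degree_diff_le
        order.trans[OF degree_pCons_le] order.trans[OF degree_smult_le] simp del: cheb.simps(3) simp: cheb.simps(3)[of "Suc m"])
  qed auto
qed

definition cheb_factor :: "real \<Rightarrow> complex poly" where
  "cheb_factor x = [:- of_real (2 * cos (pi * x)), 2:]"

lemma cheb_eq_prod:
  assumes "n \<ge> 1"
  shows "cheb n = (\<Prod>k\<in>{0<..<n}. cheb_factor (real k / real n))"
proof (rule poly_eqI_degree_lead_coeff[where n = "n - 1" and A = "(\<lambda>k. of_real (cos (pi * real k / real n))) ` {0<..<n}"])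
  let ?p = "\<Prod>k\<in>{0<..<n}. cheb_factor (real k / real n)"
  have "degree ?p = (\<Sum>k\<in>{0<..<n}. degree (cheb_factor (real k / real n)))"
    by (rule degree_prod_eq_sum_degree) (auto simp: cheb_factor_def)
  then have degp: "degree ?p = n - 1"
    by (simp add: cheb_factor_def)
  then show "degree ?p \<le> n - 1" by simp
  show "degree (cheb n) \<le> n - 1"
    using cheb_degree[of "n - 1"] assms by simp
  have "lead_coeff ?p = 2 ^ (n - 1)"
    by (simp add: lead_coeff_prod cheb_factor_def)
  then show "coeff (cheb n) (n - 1) = coeff ?p (n - 1)"
    using cheb_degree[of "n - 1"] assms degp by simp
  have "inj_on (\<lambda>k. of_real (cos (pi * real k / real n)) :: complex) {0<..<n}"
  proof (rule inj_onI)
    fix k l assume kl: "k \<in> {0<..<n}" "l \<in> {0<..<n}"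
      "of_real (cos (pi * real k / real n)) = (of_real (cos (pi * real l / real n)) :: complex)"
    have "pi * real k / real n = pi * real l / real n"
      by (rule cos_inj_pi) (use kl in \<open>auto simp: field_simps\<close>)
    then show "k = l" using kl by auto
  qed
  then show "n - 1 \<le> card ((\<lambda>k. of_real (cos (pi * real k / real n)) :: complex) ` {0<..<n})"
    by (simp add: card_image)
next
  fix z :: complex
  assume "z \<in> (\<lambda>k. of_real (cos (pi * real k / real n))) ` {0<..<n}"
  then obtain k where k: "k \<in> {0<..<n}" "z = of_real (cos (pi * real k / real n))"
    by auto
  have "sin (pi * real k / real n) > 0"
    by (rule sin_gt_zero) (use k in \<open>auto simp: field_simps\<close>)
  moreover have "sin (real n * (pi * real k / real n)) = 0"
    using k by (simp add: mult.commute)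
  ultimately have "poly (cheb n) z = 0"
    using poly_cheb_cos[of n "pi * real k / real n"] k by simp
  moreover have "poly (\<Prod>k\<in>{0<..<n}. cheb_factor (real k / real n)) z = 0"
    using k by (auto simp: poly_prod cheb_factor_def intro!: bexI[of _ k])
  ultimately show "poly (cheb n) z = poly (\<Prod>k\<in>{0<..<n}. cheb_factor (real k / real n)) z"
    by simp
qed

lemma pell_new_parts_exist:
  assumes "pell_solution D u v"
  shows "\<exists>w. pell_new_parts D u v w"
proof -
  define f where "f x = (if x = 1 then v else pcompose (cheb_factor x) u)" for x
  define w where "w n = (\<Prod>k\<in>totatives n. f (real k / real n))" for n
  have "pell_v D u v n = (\<Prod>m | m dvd n. w m)" if n: "n \<ge> 1" for n
  proof -
    have fin: "finite {m. m dvd n}" using n by simp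
    have "pell_v D u v n = f (real n / real n) * (\<Prod>k\<in>{0<..<n}. f (real k / real n))"
      using n by (simp add: pell_v_cheb[OF assms] cheb_eq_prod pcompose_prod f_def)
    also have "f (real n / real n) * (\<Prod>k\<in>{0<..<n}. f (real k / real n)) =
        (\<Prod>k\<in>insert n {0<..<n}. f (real k / real n))" by simp
    also have "insert n {0<..<n} = {0<..n}" using n by auto
    also have "(\<Prod>k\<in>{0<..n}. f (real k / real n)) =
        (\<Prod>d | d dvd n. \<Prod>k\<in>{k\<in>{0<..n}. gcd k n = d}. f (real k / real n))"
      by (rule prod.group[symmetric]) (use fin in auto)
    also have "\<dots> = (\<Prod>d | d dvd n. w (n div d))"
    proof (rule prod.cong)
      fix d assume "d \<in> {d. d dvd n}"
      then have d: "d dvd n" "d > 0" using n by (auto intro: Nat.gr0I)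
      have "(\<Prod>k\<in>{k\<in>{0<..n}. gcd k n = d}. f (real k / real n)) =
          (\<Prod>k\<in>totatives (n div d). f (real (k * d) / real n))"
        by (rule prod.reindex_bij_betw[symmetric]) (use bij_betw_totatives_gcd_eq d n in auto)
      also have "\<dots> = w (n div d)"
        using d n by (auto simp: w_def real_of_nat_div intro!: prod.cong)
      finally show "(\<Prod>k\<in>{k\<in>{0<..n}. gcd k n = d}. f (real k / real n)) = w (n div d)" .
    qed simp
    also have "\<dots> = (\<Prod>m | m dvd n. w m)"
      by (rule prod.reindex_bij_witness[of _ "\<lambda>m. n div m" "\<lambda>m. n div m"])
         (use n in \<open>auto elim!: dvdE\<close>)
    finally show ?thesis .
  qed
  then show ?thesis by (auto simp: pell_new_parts_def)
qed

end

theory Submission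
  imports Defs
begin

text \<open>For \<open>n \<ge> 2\<close> the roots of the new part of \<open>v\<^sub>n\<close> are the \<open>z\<close> with
  \<open>u(z) = cos (\<pi> k / n)\<close> for some \<open>k\<close> coprime to \<open>n\<close>, and a repeated root is also a root of
  \<open>u'\<close>.  The powers of \<open>4 u\<^sup>2 - 2\<close> modulo \<open>u'\<close> live in a rational vector space of dimension
  \<open>d - 1\<close>, so \<open>4 u(z)\<^sup>2 - 2 = 2 cos (2 \<pi> k / n)\<close> is a root of a nonzero integer polynomial of
  degree at most \<open>d - 1\<close>, and a primitive \<open>n\<close>-th root of unity is a root of one of degree at most
  \<open>2 (d - 1)\<close>.  All primitive \<open>n\<close>-th roots of unity being conjugate, \<open>\<phi>(n) \<le> 2 (d - 1)\<close>, and
  the bound follows from \<open>n / \<phi>(n) = O(ln (ln n))\<close>.\<close>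

subsection \<open>A lower bound for the totient function\<close>

definition prime_theta :: "nat \<Rightarrow> real" where
  "prime_theta n = (\<Sum>p | prime p \<and> p \<le> n. ln (real p))"

lemma finite_primes_le [simp, intro]: "finite {p::nat. prime p \<and> p \<le> n}"
  by (rule finite_subset[of _ "{..n}"]) auto

text \<open>Chebyshev's argument: a prime in \<open>{n<..2*n}\<close> divides
  \<open>fact (2 * n)\<close> but not \<open>fact n\<close>, hence it divides the central binomial
  coefficient. So does the product of these primes, which is therefore at most
  \<open>2 ^ (2 * n)\<close>.\<close>

lemma prime_theta_double: "prime_theta (2 * n) \<le> prime_theta n + 2 * real n"
proof -
  let ?S = "{p::nat. prime p \<and> n < p \<and> p \<le> 2 * n}"
  have fin: "finite ?S" by (rule finite_subset[of _ "{..2*n}"]) auto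
  have dvd: "p dvd (2 * n choose n)" if p: "p \<in> ?S" for p
  proof -
    have "p dvd fact (2 * n)" using p by (auto simp: prime_dvd_fact_iff)
    also have "(fact (2 * n) :: nat) = fact n * fact n * (2 * n choose n)"
      using binomial_fact_lemma[of n "2 * n"] by simp
    finally show ?thesis using p by (auto simp: prime_dvd_mult_iff prime_dvd_fact_iff)
  qed
  have "(\<Prod>p\<in>T. p) dvd (2 * n choose n)" if "finite T" "T \<subseteq> ?S" for T
    using that
  proof (induction T rule: finite_induct)
    case (insert q T)
    have "coprime q (\<Prod>p\<in>T. p)"
      using insert by (intro prod_coprime_right) (auto intro!: primes_coprime)
    then show ?case using insert dvd by (auto intro: divides_mult)
  qed simp
  from this[OF fin] have "(\<Prod>p\<in>?S. p) \<le> (2 * n choose n)"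
    by (intro dvd_imp_le) auto
  also have "\<dots> \<le> 2 ^ (2 * n)" by (rule binomial_le_pow2)
  finally have "real (\<Prod>p\<in>?S. p) \<le> real (2 ^ (2 * n))" using of_nat_mono by blast
  then have "ln (real (\<Prod>p\<in>?S. p)) \<le> ln (2 ^ (2 * n))"
    by (subst ln_le_cancel_iff) (auto intro!: prod_pos simp: prime_gt_0_nat)
  also have "\<dots> = 2 * real n * ln 2" by (simp add: ln_realpow)
  also have "\<dots> \<le> 2 * real n * 1" by (intro mult_left_mono) (use ln_2_less_1 in auto)
  also have "ln (real (\<Prod>p\<in>?S. p)) = (\<Sum>p\<in>?S. ln (real p))"
    by (simp only: of_nat_prod) (rule ln_prod, auto simp: prime_gt_0_nat)
  finally have "(\<Sum>p\<in>?S. ln (real p)) \<le> 2 * real n" by simp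
  moreover have "prime_theta (2 * n) = prime_theta n + (\<Sum>p\<in>?S. ln (real p))"
    unfolding prime_theta_def
    by (subst sum.union_disjoint[symmetric]) (auto simp: fin intro!: sum.cong)
  ultimately show ?thesis by simp
qed

lemma prime_theta_Suc: "prime_theta (Suc n) \<le> prime_theta n + ln (real (Suc n))"
proof -
  have "prime_theta (Suc n) \<le> (\<Sum>p\<in>insert (Suc n) {p. prime p \<and> p \<le> n}. ln (real p))"
    unfolding prime_theta_def by (rule sum_mono2) auto
  also have "\<dots> = prime_theta n + ln (real (Suc n))"
    by (simp add: prime_theta_def)
  finally show ?thesis .
qed

text \<open>Induction by halving. For \<open>n = Suc (2 * k)\<close> the induction hypothesis gives
  \<open>4 * k\<close>, the doubling step \<open>2 * k\<close>, and the odd step at most another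
  \<open>2 * k\<close>, so the constant 4 suffices.\<close>

lemma prime_theta_le: "prime_theta n \<le> 4 * real n"
proof (induction n rule: less_induct)
  case (less n)
  consider "n = 0" | k where "n = 2 * k" "k > 0" | k where "n = Suc (2 * k)"
    by (metis evenE oddE gr0I mult_0_right Suc_eq_plus1)
  then show ?case
  proof cases
    case 1
    have "{p::nat. prime p \<and> p = 0} = {}" by auto
    then show ?thesis using 1 by (simp add: prime_theta_def)
  next
    case 2
    then show ?thesis using less[of k] prime_theta_double[of k] by simp
  next
    case 3
    have "ln (real (Suc (2 * k))) \<le> 2 * real k" using ln_add_one_self_le_self[of "2 * real k"] by (simp add: add.commute)
    then show ?thesis using 3 less[of k] prime_theta_double[of k] prime_theta_Suc[of "2 * k"] by simp
  qed
qed

section \<open>Mertens-type estimates for sums over primes\<close>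

lemma prime_power_dvd_fact: "p > 0 \<Longrightarrow> p ^ (n div p) dvd (fact n :: nat)"
proof -
  assume p: "p > 0"
  have "p ^ k dvd fact (p * k)" for k
  proof (induction k)
    case (Suc k)
    have "p ^ k * p dvd fact (p * k) * (p * Suc k)"
      using Suc by (intro mult_dvd_mono) auto
    also have "fact (p * k) * (p * Suc k) dvd (fact (p * Suc k) :: nat)"
    proof -
      obtain m where m: "p * Suc k = Suc m" using p by (metis mult_is_0 not0_implies_Suc nat.distinct(1) neq0_conv)
      then have "p * k \<le> m" using p by simp
      then have "(fact (p * k) :: nat) dvd fact m" by (rule fact_dvd)
      then show ?thesis by (simp only: m fact_Suc of_nat_id mult.commute[of "Suc m"]) (rule mult_dvd_mono, auto)
    qed
    finally show ?case by (simp add: mult.commute)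
  qed simp
  then have "p ^ (n div p) dvd fact (p * (n div p))" .
  also have "\<dots> dvd (fact n :: nat)" by (rule fact_dvd) simp
  finally show ?thesis .
qed

text \<open>The upper half of Mertens' first theorem: the powers \<open>p ^ (n div p)\<close> are
  pairwise coprime divisors of \<open>fact n\<close>, so their product is at most
  \<open>n ^ n\<close>. Replacing \<open>n div p\<close> by \<open>n / p\<close> costs at most
  \<open>prime_theta n\<close>, which accounts for the summand 4.\<close>

lemma sum_prime_ln_over_le:
  assumes "n > 0"
  shows "(\<Sum>p | prime p \<and> p \<le> n. ln (real p) / real p) \<le> ln (real n) + 4"
proof -
  let ?S = "{p::nat. prime p \<and> p \<le> n}"
  have "(\<Prod>p\<in>T. p ^ (n div p)) dvd (fact n :: nat)" if "finite T" "T \<subseteq> ?S" for T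
    using that
  proof (induction T rule: finite_induct)
    case (insert q T)
    have "coprime (q ^ (n div q)) (\<Prod>p\<in>T. p ^ (n div p))"
      using insert by (intro prod_coprime_right) (auto intro!: primes_coprime)
    then show ?case using insert by (auto intro!: divides_mult prime_power_dvd_fact prime_gt_0_nat)
  qed simp
  from this[of ?S] have "(\<Prod>p\<in>?S. p ^ (n div p)) \<le> (fact n :: nat)"
    by (intro dvd_imp_le) auto
  also have "\<dots> \<le> n ^ n" using fact_le_power[of n, where 'a = nat] by simp
  finally have "real (\<Prod>p\<in>?S. p ^ (n div p)) \<le> real (n ^ n)" using of_nat_mono by blast
  then have "ln (real (\<Prod>p\<in>?S. p ^ (n div p))) \<le> ln (real (n ^ n))"
    using assms by (subst ln_le_cancel_iff) (auto intro!: prod_pos simp: prime_gt_0_nat)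
  also have "\<dots> = real n * ln (real n)" using assms by (simp add: ln_realpow)
  also have "ln (real (\<Prod>p\<in>?S. p ^ (n div p))) = (\<Sum>p\<in>?S. real (n div p) * ln (real p))"
    by (simp only: of_nat_prod, subst ln_prod) (auto simp: prime_gt_0_nat ln_realpow)
  finally have 1: "(\<Sum>p\<in>?S. real (n div p) * ln (real p)) \<le> real n * ln (real n)" .
  have "real n * (\<Sum>p\<in>?S. ln (real p) / real p) = (\<Sum>p\<in>?S. real n / real p * ln (real p))"
    by (simp add: sum_distrib_left)
  also have "\<dots> \<le> (\<Sum>p\<in>?S. (real (n div p) + 1) * ln (real p))"
  proof (intro sum_mono mult_right_mono)
    fix p assume p: "p \<in> ?S"
    then have "p \<ge> 1" using prime_ge_1_nat by auto
    then show "ln (real p) \<ge> 0" by simp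
    show "real n / real p \<le> real (n div p) + 1"
    proof -
      have "n \<le> (n div p + 1) * p"
        using dividend_less_div_times[of p n] \<open>p \<ge> 1\<close> by simp
      then have "real n \<le> (real (n div p) + 1) * real p"
        by (metis of_nat_le_iff of_nat_mult of_nat_add of_nat_1)
      then show ?thesis using \<open>p \<ge> 1\<close> by (simp add: divide_le_eq)
    qed
  qed
  also have "\<dots> = (\<Sum>p\<in>?S. real (n div p) * ln (real p)) + prime_theta n"
    by (simp add: prime_theta_def sum.distrib algebra_simps)
  also have "\<dots> \<le> real n * ln (real n) + 4 * real n" using 1 prime_theta_le[of n] by simp
  also have "\<dots> = real n * (ln (real n) + 4)" by (simp add: algebra_simps)
  finally show ?thesis using assms by simp
qed

text \<open>Summation by parts writes both sides as combinations of partial sums with the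
  coefficients \<open>w n\<close> and \<open>w k - w (Suc k)\<close>, which are nonnegative.\<close>

lemma abel_sum_mono:
  fixes a b w :: "nat \<Rightarrow> real"
  assumes "\<And>k. k \<le> n \<Longrightarrow> sum a {..k} \<le> sum b {..k}"
    and "\<And>k. w (Suc k) \<le> w k" "\<And>k. w k \<ge> 0"
  shows "(\<Sum>k\<le>n. a k * w k) \<le> (\<Sum>k\<le>n. b k * w k)"
proof -
  have *: "(\<Sum>k\<le>n. c k * w k) = sum c {..n} * w n + (\<Sum>k<n. sum c {..k} * (w k - w (Suc k)))"
    for c :: "nat \<Rightarrow> real"
  proof (induction n)
    case (Suc n)
    then show ?case by (simp add: algebra_simps sum.atMost_Suc)
  qed simp
  show ?thesis unfolding *
    using assms by (intro add_mono sum_mono[of "{..<n}"] mult_right_mono) auto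
qed

lemma half_le_ln_2: "1 / 2 \<le> ln (2 :: real)"
  using ln_le_minus_one[of "1 / 2 :: real"] by (simp add: ln_div)

text \<open>The point of the weight \<open>1 / ln k\<close> is that
  \<open>(ln k - ln (k - 1)) / ln k \<le> ln (ln k) - ln (ln (k - 1))\<close>, which telescopes; this keeps the
  coefficient of \<open>ln (ln n)\<close> equal to \<open>1\<close>.\<close>

lemma sum_prime_inverse_le:
  assumes "n \<ge> 2"
  shows "(\<Sum>p | prime p \<and> p \<le> n. 1 / real p) \<le> ln (ln (real n)) + 10"
proof -
  \<comment> \<open>The \<open>max 2 k\<close> keeps the weight positive and decreasing also at 0
    and 1, where \<open>a\<close> and \<open>b\<close> vanish.\<close>
  define w where "w k = 1 / ln (real (max 2 k))" for k
  define a where "a k = (if prime k then ln (real k) / real k else 0)" for k :: nat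
  \<comment> \<open>Chosen such that the partial sums from 2 on are exactly the bound
    \<open>ln k + 4\<close> known for those of \<open>a\<close>.\<close>
  define b where "b k = (if k < 2 then 0 else if k = 2 then ln 2 + 4 else ln (real k) - ln (real (k - 1)))" for k :: nat
  have asum: "sum a {..k} = (\<Sum>p | prime p \<and> p \<le> k. ln (real p) / real p)" for k
    unfolding a_def by (subst sum.inter_filter[symmetric]) (auto intro!: sum.cong)
  have bsum: "sum b {..k} = ln (real k) + 4" if "k \<ge> 2" for k
    using that
  proof (induction k rule: dec_induct)
    case base
    show ?case by (simp add: b_def numeral_2_eq_2)
  next
    case (step k)
    then show ?case by (simp add: b_def)
  qed
  have "(\<Sum>p | prime p \<and> p \<le> n. 1 / real p) = (\<Sum>k\<le>n. a k * w k)"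
  proof -
    have "(\<Sum>k\<le>n. a k * w k) = (\<Sum>k\<in>{..n}. if prime k then 1 / real k else 0)"
    proof (rule sum.cong)
      fix k
      show "a k * w k = (if prime k then 1 / real k else 0)"
        using prime_ge_2_nat[of k] by (auto simp: a_def w_def max_def)
    qed simp
    then show ?thesis by (subst (asm) sum.inter_filter[symmetric]) (auto intro!: sum.cong)
  qed
  also have "\<dots> \<le> (\<Sum>k\<le>n. b k * w k)"
  proof (rule abel_sum_mono)
    fix k
    show "sum a {..k} \<le> sum b {..k}"
    proof (cases "k \<ge> 2")
      case True
      then show ?thesis using sum_prime_ln_over_le[of k] by (simp add: asum bsum)
    next
      case False
      then have "a i = 0" "b i = 0" if "i \<le> k" for i 
        using that prime_ge_2_nat[of i] by (auto simp: a_def b_def)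
      then show ?thesis by simp
    qed
    show "w (Suc k) \<le> w k"
      unfolding w_def by (intro divide_left_mono) auto
    show "w k \<ge> 0" by (simp add: w_def)
  qed
  also have "\<dots> \<le> ln (ln (real n)) + 10"
    using assms
  proof (induction n rule: dec_induct)
    case base
    \<comment> \<open>The constant 10 comes from here: the sum is at most 9, and
      \<open>ln (ln 2)\<close> is at least -1.\<close>
    have "(\<Sum>k\<le>2. b k * w k) = (ln 2 + 4) / ln 2" by (simp add: b_def w_def numeral_2_eq_2)
    also have "\<dots> = 1 + 4 / ln 2" by (simp add: field_simps)
    also have "4 / ln (2::real) \<le> 4 / (1/2)" using half_le_ln_2 by (intro divide_left_mono) auto
    finally have "(\<Sum>k\<le>2. b k * w k) \<le> 9" by simp
    moreover have "ln (ln (2::real)) \<ge> ln (1/2)" using half_le_ln_2 by (subst ln_le_cancel_iff) auto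
    moreover have "ln (1/2::real) \<ge> -1" using ln_2_less_1 by (simp add: ln_div)
    ultimately show ?case unfolding of_nat_numeral by linarith
  next
    case (step k)
    define x where "x = ln (real (Suc k))"
    define y where "y = ln (real k)"
    have xy: "x > 0" "y > 0" using step by (auto simp: x_def y_def)
    have "ln (y / x) \<le> y / x - 1" using xy by (intro ln_le_minus_one) auto
    then have "(x - y) / x \<le> ln x - ln y" using xy by (simp add: ln_div field_simps)
    then show ?case using step by (simp add: b_def w_def x_def y_def max_def)
  qed
  finally show ?thesis .
qed

section \<open>From sums over primes to the totient\<close>

lemma card_prime_factors_le:
  assumes "n > 0"
  shows "2 ^ card (prime_factors n) \<le> (n::nat)"
proof -
  have "2 ^ card (prime_factors n) = (\<Prod>p\<in>prime_factors n. 2::nat)" by simp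
  also have "\<dots> \<le> (\<Prod>p\<in>prime_factors n. p)"
    by (intro prod_mono) (auto intro: prime_ge_2_nat in_prime_factors_imp_prime)
  also have "\<dots> \<le> (\<Prod>p\<in>prime_factors n. p ^ multiplicity p n)"
  proof (intro prod_mono conjI)
    fix p assume p: "p \<in> prime_factors n"
    then have "multiplicity p n > 0" "p > 0" 
      by (auto simp: prime_factors_multiplicity prime_gt_0_nat)
    then show "p \<le> p ^ multiplicity p n" by (intro self_le_power) auto
  qed auto
  also have "\<dots> = n" using prime_factorization_nat[of n] assms by simp
  finally show ?thesis .
qed

text \<open>The terms telescope, being \<open>1 / (p - 1) - 1 / p\<close>.\<close>

lemma sum_inverse_pred_diff_le:
  assumes "finite S" "\<And>p. p \<in> S \<Longrightarrow> p \<ge> (2::nat)"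
  shows "(\<Sum>p\<in>S. 1 / (real p * (real p - 1))) \<le> 1"
proof -
  obtain N where N: "S \<subseteq> {2..<N+2}"
  proof -
    have "S \<subseteq> {2..<Max (insert 0 S) + 1 + 2}"
      using assms(1) assms(2) by (auto intro!: le_imp_less_Suc le_SucI)
    then show ?thesis using that by blast
  qed
  have "(\<Sum>p\<in>S. 1 / (real p * (real p - 1))) \<le> (\<Sum>p\<in>{2..<N+2}. 1 / (real p * (real p - 1)))"
    by (rule sum_mono2) (use N in auto)
  also have "\<dots> = 1 - 1 / real (N + 1)"
  proof (induction N)
    case (Suc N)
    have "(\<Sum>p\<in>{2..<Suc N + 2}. 1 / (real p * (real p - 1)))
      = 1 - 1 / (real N + 1) + 1 / ((real N + 2) * (real N + 1))"
      using Suc by (simp add: add.commute)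
    also have "\<dots> = 1 - 1 / (real N + 2)"
      by (simp add: divide_simps) (simp add: algebra_simps)
    finally show ?case by (simp add: add.commute)
  qed simp
  finally show ?thesis by (smt (verit) of_nat_0_le_iff divide_nonneg_nonneg)
qed

text \<open>In \<open>totient n / n = (\<Prod>p. 1 - 1 / p)\<close> the logarithm is minus the sum
  of \<open>1 / p\<close> over the prime factors, up to an error of at most 1. Primes up to about
  \<open>ln n\<close> contribute at most about \<open>ln (ln (ln n))\<close>; there are at most
  \<open>2 * ln n\<close> larger ones, each contributing at most \<open>1 / ln n\<close>.\<close>

lemma le_totient_ln_ln:
  assumes n: "n \<ge> 3"
  shows "real n \<le> exp 14 * real (totient n) * (1 + ln (ln (real n)))"
proof -
  let ?P = "prime_factors n"
  define l where "l = ln (real n)"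
  \<comment> \<open>The cutoff is an integer just above \<open>ln n\<close>; the added 1 ensures
    \<open>Y \<ge> 2\<close>, as the estimate of the sum over small primes requires.\<close>
  define Y where "Y = nat \<lceil>l\<rceil> + 1"
  have l: "l \<ge> 1"
    unfolding l_def using exp_le n by (subst ln_ge_iff) (auto intro: order.trans)
  have Y: "Y \<ge> 2" "real Y \<ge> l" "real Y \<le> l + 2" unfolding Y_def using l by linarith+
  have pr: "p \<ge> 2" if "p \<in> ?P" for p using that prime_ge_2_nat by auto
  have "(\<Sum>p\<in>?P. 1 / real p) \<le> ln (ln (real Y)) + 12"
  proof -
    have "(\<Sum>p\<in>?P. 1 / real p) = (\<Sum>p\<in>{p\<in>?P. p \<le> Y}. 1 / real p) + (\<Sum>p\<in>{p\<in>?P. \<not> p \<le> Y}. 1 / real p)"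
      by (subst sum.union_disjoint[symmetric]) (auto intro!: sum.cong)
    also have "(\<Sum>p\<in>{p\<in>?P. p \<le> Y}. 1 / real p) \<le> (\<Sum>p | prime p \<and> p \<le> Y. 1 / real p)"
      by (rule sum_mono2) auto
    also have "\<dots> \<le> ln (ln (real Y)) + 10" by (rule sum_prime_inverse_le) (rule Y)
    also have "(\<Sum>p\<in>{p\<in>?P. \<not> p \<le> Y}. 1 / real p) \<le> (\<Sum>p\<in>{p\<in>?P. \<not> p \<le> Y}. 1 / l)"
      using Y l by (intro sum_mono divide_left_mono) auto
    also have "\<dots> \<le> real (card ?P) / l"
      using l by (auto intro!: divide_right_mono card_mono)
    also have "\<dots> \<le> 2"
    proof -
      have "real (2 ^ card ?P) \<le> real n" using card_prime_factors_le[of n] n of_nat_mono by (metis gr0I not_numeral_le_zero)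
      then have "ln (2 ^ card ?P) \<le> l" unfolding l_def by (subst ln_le_cancel_iff) (use n in auto)
      then have "real (card ?P) * ln 2 \<le> l" by (simp add: ln_realpow)
      moreover have "real (card ?P) * (1/2) \<le> real (card ?P) * ln 2"
        using half_le_ln_2 by (intro mult_left_mono) auto
      ultimately have "real (card ?P) \<le> 2 * l" by simp
      then show ?thesis using l by (simp add: field_simps)
    qed
    finally show ?thesis by simp
  qed
  moreover have "- ln (1 - 1 / real p) \<le> 1 / real p + 1 / (real p * (real p - 1))" if "p \<in> ?P" for p
  proof -
    have p: "real p > 1" using pr[OF that] by simp
    have "- ln (1 - 1 / real p) = ln (real p / (real p - 1))"
      using p by (simp add: ln_div field_simps flip: ln_inverse)
    also have "\<dots> \<le> real p / (real p - 1) - 1" using p by (intro ln_le_minus_one) auto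
    also have "\<dots> = 1 / real p + 1 / (real p * (real p - 1))" using p by (simp add: field_simps)
    finally show ?thesis .
  qed
  then have "(\<Sum>p\<in>?P. - ln (1 - 1 / real p)) \<le> (\<Sum>p\<in>?P. 1 / real p) + (\<Sum>p\<in>?P. 1 / (real p * (real p - 1)))"
    by (simp add: sum_mono flip: sum.distrib)
  moreover have "(\<Sum>p\<in>?P. 1 / (real p * (real p - 1))) \<le> 1"
    by (rule sum_inverse_pred_diff_le) (use pr in auto)
  ultimately have "(\<Sum>p\<in>?P. - ln (1 - 1 / real p)) \<le> ln (ln (real Y)) + 13" by linarith
  moreover have "ln (\<Prod>p\<in>?P. 1 - 1 / real p) = (\<Sum>p\<in>?P. ln (1 - 1 / real p))"
    using pr by (intro ln_prod) (force simp: field_simps)+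
  ultimately have "- 13 - ln (ln (real Y)) \<le> ln (\<Prod>p\<in>?P. 1 - 1 / real p)"
    by (simp add: sum_negf)
  moreover have pos: "(\<Prod>p\<in>?P. 1 - 1 / real p) > 0"
    using pr by (intro prod_pos) (force simp: field_simps)
  ultimately have "exp (- 13 - ln (ln (real Y))) \<le> (\<Prod>p\<in>?P. 1 - 1 / real p)"
    by (simp add: ln_ge_iff)
  moreover have lY: "ln (real Y) > 0" using Y by simp
  ultimately have "1 \<le> exp 13 * ln (real Y) * (\<Prod>p\<in>?P. 1 - 1 / real p)"
    by (simp add: exp_diff exp_minus field_simps)
  then have "real n * 1 \<le> real n * (exp 13 * ln (real Y) * (\<Prod>p\<in>?P. 1 - 1 / real p))"
    by (intro mult_left_mono) auto
  also have "\<dots> = exp 13 * real (totient n) * ln (real Y)"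
    using totient_formula2[of n] n by (simp add: mult_ac)
  \<comment> \<open>The exponent 13 is 10 + 2 + 1, from the small primes, the large primes and the
    error of the logarithm; passing from \<open>ln Y\<close> to \<open>1 + ln (ln n)\<close> costs
    one more factor \<open>exp 1\<close>.\<close>
  also have "\<dots> \<le> exp 13 * real (totient n) * (exp 1 * (1 + ln (ln (real n))))"
  proof (intro mult_left_mono)
    have "real Y \<le> exp 2 * l" 
    proof -
      have "(3::real) \<le> exp 2" using exp_ge_add_one_self[of 2] by simp
      then have "3 * l \<le> exp 2 * l" using l by (intro mult_right_mono) auto
      then show ?thesis using Y l by linarith
    qed
    then have "ln (real Y) \<le> ln (exp 2 * l)" using Y l by (subst ln_le_cancel_iff) auto
    also have "\<dots> = 2 + ln l" using l by (simp add: ln_mult)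
    also have "\<dots> \<le> 2 * (1 + ln l)" using l by simp
    also have "\<dots> \<le> exp 1 * (1 + ln l)"
      using l exp_ge_add_one_self[of 1] by (intro mult_right_mono) auto
    finally show "ln (real Y) \<le> exp 1 * (1 + ln (ln (real n)))" by (simp add: l_def)
  qed auto
  also have "\<dots> = exp 14 * real (totient n) * (1 + ln (ln (real n)))"
    using exp_add[of 13 "1::real"] by simp
  finally show ?thesis by simp
qed

subsection \<open>Conjugates of roots of unity\<close>

text \<open>Stated for an arbitrary additive \<open>f\<close> in order to serve both
  \<open>of_int\<close> and \<open>of_rat\<close>.\<close>

lemma poly_map_poly_add:
  assumes "f 0 = 0" "\<And>a b. f (a + b) = f a + f b"
  shows "poly (map_poly f (p + q)) z = poly (map_poly f p) z + poly (map_poly f q) z"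
  by (induction p q rule: poly_induct2) (use assms in \<open>auto simp: map_poly_pCons algebra_simps\<close>)

lemma poly_map_poly_smult:
  assumes "f 0 = 0" "\<And>a b. f (a * b) = f a * f b"
  shows "poly (map_poly f (smult c p)) z = f c * poly (map_poly f p) z"
  using assms by (simp add: map_poly_smult)

lemma poly_map_poly_mult:
  fixes f :: "'a::comm_semiring_0 \<Rightarrow> 'b::comm_semiring_0"
  assumes "f 0 = 0" "\<And>a b. f (a + b) = f a + f b" "\<And>a b. f (a * b) = f a * f b"
  shows "poly (map_poly f (p * q)) z = poly (map_poly f p) z * poly (map_poly f q) z"
  by (induction p) (use assms in \<open>auto simp: map_poly_pCons algebra_simps map_poly_smult poly_map_poly_add\<close>)

abbreviation ieval :: "int poly \<Rightarrow> complex \<Rightarrow> complex" where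
  "ieval p z \<equiv> poly (map_poly of_int p) z"

lemma ieval_add [simp]: "ieval (p + q) z = ieval p z + ieval q z"
  by (rule poly_map_poly_add) auto

lemma ieval_mult [simp]: "ieval (p * q) z = ieval p z * ieval q z"
  by (rule poly_map_poly_mult) auto

lemma ieval_smult [simp]: "ieval (smult c p) z = of_int c * ieval p z"
  by (rule poly_map_poly_smult) auto

lemma ieval_pCons [simp]: "ieval (pCons a p) z = of_int a + z * ieval p z"
  by (simp add: map_poly_pCons)

lemma ieval_diff [simp]: "ieval (p - q) z = ieval p z - ieval q z"
  using ieval_add[of "p - q" q z] by (simp add: algebra_simps)

lemma ieval_power [simp]: "ieval (p ^ n) z = ieval p z ^ n"
  by (induction n) auto

lemma ieval_sum [simp]: "ieval (sum f A) z = (\<Sum>x\<in>A. ieval (f x) z)"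
  by (induction A rule: infinite_finite_induct) auto

lemma ieval_monom [simp]: "ieval (monom c n) z = of_int c * z ^ n"
  by (simp add: map_poly_monom poly_monom)

lemma ieval_pcompose [simp]: "ieval (pcompose p q) z = ieval p (ieval q z)"
  by (induction p) (auto simp: pcompose_pCons)

lemma ieval_altdef: "ieval p z = (\<Sum>i\<le>degree p. of_int (coeff p i) * z ^ i)"
  by (simp add: poly_altdef coeff_map_poly degree_map_poly)

section \<open>The Frobenius congruence modulo a prime\<close>

lemma prime_dvd_add_power_diff:
  fixes a b :: "'a::comm_ring_1"
  assumes "prime (p::nat)"
  shows "of_nat p dvd (a + b) ^ p - a ^ p - b ^ p"
proof -
  have p: "p > 0" using assms prime_gt_0_nat by blast
  have "(a + b) ^ p = (\<Sum>k\<le>p. of_nat (p choose k) * a ^ k * b ^ (p - k))"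
    by (rule binomial_ring)
  also have "{..p} = insert 0 (insert p {0<..<p})" by auto
  also have "(\<Sum>k\<in>\<dots>. of_nat (p choose k) * a ^ k * b ^ (p - k))
      = b ^ p + (a ^ p + (\<Sum>k\<in>{0<..<p}. of_nat (p choose k) * a ^ k * b ^ (p - k)))"
    using p by simp
  finally have "(a + b) ^ p - a ^ p - b ^ p = (\<Sum>k\<in>{0<..<p}. of_nat (p choose k) * a ^ k * b ^ (p - k))"
    by simp
  also have "of_nat p dvd \<dots>"
  proof (intro dvd_sum dvd_mult2)
    fix k assume "k \<in> {0<..<p}"
    then have "p dvd (p choose k)"
      using assms by (intro dvd_choose_prime) auto
    then show "(of_nat p :: 'a) dvd of_nat (p choose k)"
      by (metis dvd_def of_nat_mult)
  qed
  finally show ?thesis .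
qed

text \<open>Fermat's little theorem: by the binomial congruence, \<open>a ^ p - a\<close> changes by
  a multiple of \<open>p\<close> when \<open>a\<close> changes by 1, so induction from 0 in both
  directions applies.\<close>

lemma prime_dvd_power_diff_self:
  assumes "prime (p::nat)"
  shows "int p dvd a ^ p - a"
proof -
  have step: "int p dvd (a + 1) ^ p - (a + 1) \<longleftrightarrow> int p dvd a ^ p - a" for a :: int
  proof -
    have "int p dvd ((a + 1) ^ p - (a + 1)) - (a ^ p - a)"
      using prime_dvd_add_power_diff[OF assms, of a "1::int"] by (simp add: algebra_simps)
    then show ?thesis by (metis dvd_diff_left_iff dvd_diff_right_iff)
  qed
  show ?thesis
  proof (induction a rule: int_induct[where k = 0])
    case base
    show ?case using assms prime_gt_0_nat by (simp add: power_0_left)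
  next
    case (step1 i)
    then show ?case using step[of i] by simp
  next
    case (step2 i)
    then show ?case using step[of "i - 1"] by simp
  qed
qed

text \<open>Induction on the coefficients: the binomial congruence splits the power of
  \<open>a + X * F\<close>, and Fermat's theorem takes care of the constant
  \<open>a\<close>.\<close>

lemma prime_dvd_frobenius_diff:
  fixes F :: "int poly"
  assumes "prime (p::nat)"
  shows "of_nat p dvd pcompose F (monom 1 p) - F ^ p"
proof (induction F)
  case 0
  show ?case using assms prime_gt_0_nat by (simp add: power_0_left)
next
  case (pCons a F)
  have eq: "pCons a F = [:a:] + monom 1 1 * F"
    by (simp add: monom_altdef)
  have 1: "(of_nat p :: int poly) dvd [:a:] - [:a:] ^ p"
  proof -
    obtain k where "a - a ^ p = int p * k"
      using prime_dvd_power_diff_self[OF assms, of a] by (metis dvd_def dvd_diff_commute)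
    then have "[:a:] - [:a:] ^ p = of_nat p * [:k:]"
      by (simp add: poly_const_pow of_nat_poly)
    then show ?thesis by (rule dvdI)
  qed
  have 2: "(of_nat p :: int poly) dvd ([:a:] + monom 1 1 * F) ^ p - [:a:] ^ p - (monom 1 1 * F) ^ p"
    by (rule prime_dvd_add_power_diff[OF assms])
  have 3: "(of_nat p :: int poly) dvd monom 1 p * (pcompose F (monom 1 p) - F ^ p)"
    using pCons.IH by simp
  have pX: "pcompose (monom 1 1) (monom 1 p) = monom (1::int) p"
    by (simp add: monom_altdef pcompose_pCons)
  have "pcompose (pCons a F) (monom 1 p) - pCons a F ^ p
     = ([:a:] - [:a:] ^ p) + monom 1 p * (pcompose F (monom 1 p) - F ^ p)
       - (([:a:] + monom 1 1 * F) ^ p - [:a:] ^ p - (monom 1 1 * F) ^ p)"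
    by (simp add: eq pcompose_add pcompose_mult pX[simplified] power_mult_distrib monom_power algebra_simps)
  then show ?case using 1 2 3 by (metis dvd_add dvd_diff)
qed


text \<open>Landau's argument.  Let \<open>F\<close> be an integer polynomial of minimal degree with root \<open>z\<close>.
  Up to a fixed factor \<open>M\<close>, all values \<open>F(z ^ k)\<close> are integer combinations of
  \<open>1, z, ..., z ^ (deg F - 1)\<close>, with coefficients bounded by some \<open>A\<close> since \<open>k\<close> matters only
  modulo \<open>N\<close>.  As \<open>F(z ^ p) \<equiv> F(z) ^ p = 0\<close> modulo \<open>p\<close>, for \<open>p > A\<close> these coefficients
  vanish.\<close>

lemma root_of_unity_large_prime:
  fixes z :: complex
  assumes N: "N > 0" and z: "z ^ N = 1"
  shows "\<exists>A. \<forall>p>A. prime p \<longrightarrow> (\<forall>h. ieval h z = 0 \<longrightarrow> ieval h (z ^ p) = 0)"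
proof -
  let ?P = "\<lambda>h. h \<noteq> 0 \<and> ieval h z = 0"
  have "?P (monom 1 N - 1)"
  proof
    have "coeff (monom 1 N - 1 :: int poly) N = 1" using N by (simp add: coeff_1)
    then show "monom 1 N - 1 \<noteq> (0 :: int poly)" by (metis coeff_0 zero_neq_one)
    show "ieval (monom 1 N - 1) z = 0" using z by simp
  qed
  from ex_has_least_nat[of ?P, OF this, of degree]
  obtain F where F: "F \<noteq> 0" "ieval F z = 0" and "\<And>r. ?P r \<Longrightarrow> degree F \<le> degree r"
    by blast
  then have min: "r = 0" if "ieval r z = 0" "degree r < degree F" for r
    using that by (metis not_le)
  define m where "m = degree F"
  define L where "L = lead_coeff F"
  have L: "L \<noteq> 0" using F by (simp add: L_def)
  have m: "m > 0"
  proof (rule ccontr)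
    assume "\<not> m > 0"
    then obtain c where "F = [:c:]" by (metis m_def degree_eq_zeroE gr0I)
    then show False using F by simp
  qed

  \<comment> \<open>\<open>F\<close> need not be monic, so each multiplication by \<open>z\<close>
    followed by a reduction costs one factor \<open>L\<close>.\<close>
  have red: "\<exists>r. degree r < m \<and> ieval r z = of_int (L ^ j) * z ^ j" for j
  proof (induction j)
    case 0
    show ?case by (rule exI[of _ 1]) (use m in simp)
  next
    case (Suc j)
    then obtain r where r: "degree r < m" "ieval r z = of_int (L ^ j) * z ^ j" by blast
    define r' where "r' = smult L (pCons 0 r) - smult (coeff (pCons 0 r) m) F"
    have "degree (pCons 0 r) \<le> m" using r by (intro order.trans[OF degree_pCons_le]) simp
    then have "degree r' \<le> m"
      unfolding r'_def by (intro degree_diff_le order.trans[OF degree_smult_le]) (auto simp: m_def)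
    moreover have "coeff r' m = 0" by (simp add: r'_def L_def m_def coeff_pCons split: nat.split)
    ultimately have "degree r' < m"
      using m by (metis degree_0 le_neq_implies_less leading_coeff_0_iff)
    moreover have "ieval r' z = of_int (L ^ Suc j) * z ^ Suc j"
      using r F by (simp add: r'_def)
    ultimately show ?case by blast
  qed
  then obtain R0 where R0: "\<And>j. degree (R0 j) < m" "\<And>j. ieval (R0 j) z = of_int (L ^ j) * z ^ j"
    by metis

  \<comment> \<open>As \<open>z ^ i\<close> depends only on \<open>i mod N\<close>, fewer than
    \<open>N\<close> reductions are ever needed. Thus \<open>L ^ N\<close> is a common factor for
    all \<open>g\<close>, whatever their degree.\<close>
  have "\<exists>r. degree r < m \<and> ieval r z = of_int (L ^ N) * ieval g z" for g
  proof -
    define r where "r = (\<Sum>i\<le>degree g. smult (coeff g i * L ^ (N - i mod N)) (R0 (i mod N)))"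
    have "degree r < m"
      unfolding r_def by (rule degree_sum_less) (use R0 m in \<open>auto intro: le_less_trans[OF degree_smult_le]\<close>)
    moreover have "ieval r z = of_int (L ^ N) * ieval g z"
    proof -
      have "of_int (coeff g i * L ^ (N - i mod N)) * ieval (R0 (i mod N)) z 
            = of_int (L ^ N) * (of_int (coeff g i) * z ^ i)" for i
      proof -
        have "z ^ i = z ^ (N * (i div N) + i mod N)" by simp
        also have "\<dots> = z ^ (i mod N)" using z by (simp only: power_add power_mult) simp
        finally have "z ^ (i mod N) = z ^ i" ..
        moreover have "L ^ (N - i mod N) * L ^ (i mod N) = L ^ N"
          using N by (simp flip: power_add)
        ultimately show ?thesis by (simp add: R0 mult_ac flip: of_int_mult of_int_power)
      qed
      then show ?thesis
        unfolding r_def ieval_sum ieval_smult ieval_altdef[of g] sum_distrib_left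
        by (intro sum.cong) auto
    qed
    ultimately show ?thesis by blast
  qed
  then obtain S where S: "\<And>g. degree (S g) < m" "\<And>g. ieval (S g) z = of_int (L ^ N) * ieval g z"
    by metis

  define R where "R k = S (pcompose F (monom 1 k))" for k
  define A where "A = nat (Max ((\<lambda>(k, i). \<bar>coeff (R k) i\<bar>) ` ({..<N} \<times> {..m})))"
  have A: "\<bar>coeff (R k) i\<bar> \<le> int A" if "k < N" for k i
  proof (cases "i \<le> m")
    case True
    then have "\<bar>coeff (R k) i\<bar> \<le> Max ((\<lambda>(k, i). \<bar>coeff (R k) i\<bar>) ` ({..<N} \<times> {..m}))"
      using that by (intro Max_ge) auto
    moreover from this have "0 \<le> Max ((\<lambda>(k, i). \<bar>coeff (R k) i\<bar>) ` ({..<N} \<times> {..m}))"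
      by (rule order.trans[OF abs_ge_zero])
    ultimately show ?thesis unfolding A_def by (simp only: nat_0_le)
  next
    case False
    then show ?thesis using S(1)[of "pcompose F (monom 1 k)"] by (simp add: R_def coeff_eq_0)
  qed

  have "ieval h (z ^ p) = 0" if p: "prime p" "p > A" and h: "ieval h z = 0" for p h
  proof -
    define k where "k = p mod N"
    have "z ^ p = z ^ (N * (p div N) + p mod N)" by simp
    also have "\<dots> = z ^ k" using z by (simp only: power_add power_mult k_def) simp
    finally have zk: "z ^ p = z ^ k" .
    have k: "k < N" using N by (simp add: k_def)
    obtain G where G: "pcompose F (monom 1 p) - F ^ p = of_nat p * G"
      using prime_dvd_frobenius_diff[OF p(1)] by (metis dvd_def)
    have "ieval (pcompose F (monom 1 p) - F ^ p) z = of_nat p * ieval G z"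
      unfolding G by (simp add: of_nat_poly)
    then have FG: "ieval F (z ^ p) = of_nat p * ieval G z"
      using F p(1) prime_gt_0_nat by (simp add: power_0_left)
    \<comment> \<open>Both sides have degree below \<open>m\<close> and the same value at
      \<open>z\<close>, so they agree by minimality of \<open>F\<close>.\<close>
    have "R k = smult (int p) (S G)"
    proof -
      have "degree (R k - smult (int p) (S G)) < m"
        using S unfolding R_def by (intro degree_diff_less le_less_trans[OF degree_smult_le]) auto
      moreover have "ieval (R k - smult (int p) (S G)) z = 0"
        using FG by (simp add: R_def S zk)
      ultimately show ?thesis using min unfolding m_def by (metis eq_iff_diff_eq_0)
    qed
    have "R k = 0"
    proof (rule poly_eqI)
      fix i
      have "int p dvd coeff (R k) i" using \<open>R k = smult (int p) (S G)\<close> by simp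
      moreover have "\<bar>coeff (R k) i\<bar> < int p" using A[OF k, of i] p by linarith
      ultimately show "coeff (R k) i = coeff 0 i" using dvd_imp_le_int[of "coeff (R k) i" "int p"] by (cases "coeff (R k) i = 0") auto
    qed
    then have "of_int (L ^ N) * ieval F (z ^ k) = 0"
      using S(2)[of "pcompose F (monom 1 k)"] by (simp add: R_def)
    then have Fp: "ieval F (z ^ p) = 0" using L zk by simp
    \<comment> \<open>By minimality \<open>F\<close> divides a nonzero integer multiple of every
      \<open>h\<close> with root \<open>z\<close>, so the conclusion passes from \<open>F\<close> to
      \<open>h\<close>.\<close>
    obtain a q where aq: "a \<noteq> 0" "smult a h = F * q + pseudo_mod h F"
      using pseudo_mod(1)[OF F(1)] by metis
    have "ieval (pseudo_mod h F) z = 0"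
      using arg_cong[OF aq(2), of "\<lambda>p. ieval p z"] h F by simp
    then have "pseudo_mod h F = 0" using min pseudo_mod(2)[OF F(1)] by blast
    then show ?thesis
      using arg_cong[OF aq(2), of "\<lambda>q. ieval q (z ^ p)"] Fp aq(1) by simp
  qed
  then show ?thesis by blast
qed

text \<open>The exponent \<open>k\<close> may be replaced by a congruent one modulo \<open>N\<close>
  whose prime factors are all large; its power is then taken one prime at a time.\<close>

lemma root_of_unity_conjugates:
  fixes z :: complex
  assumes N: "N > 0" and z: "z ^ N = 1" and k: "coprime k N" and h: "ieval h z = 0"
  shows "ieval h (z ^ k) = 0"
proof -
  obtain A where A: "\<And>y p h. y ^ N = 1 \<Longrightarrow> p > A y \<Longrightarrow> prime p \<Longrightarrow> ieval h y = 0 \<Longrightarrow> ieval h (y ^ p) = 0"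
    using root_of_unity_large_prime[OF N] by metis
  \<comment> \<open>The bound \<open>A y\<close> depends on the root, and the argument passes
    through several roots of unity, so the maximum over all of them is taken.\<close>
  define B where "B = Max (A ` {y. y ^ N = 1})"
  have B: "A y \<le> B" if "y ^ N = 1" for y
    unfolding B_def using that finite_roots_unity[of N] N by (intro Max_ge) auto
  have *: "ieval h (y ^ j) = 0"
    if "y ^ N = 1" "j > 0" "\<And>p. prime p \<Longrightarrow> p dvd j \<Longrightarrow> p > B" "ieval h y = 0" for y j
    using that
  proof (induction j arbitrary: y rule: less_induct)
    case (less j)
    show ?case
    proof (cases "j = 1")
      case False
      then obtain p where p: "prime p" "p dvd j" using prime_factor_nat by blast
      then obtain i where i: "j = p * i" by blast
      have "ieval h (y ^ p) = 0" using A B less.prems p by (meson le_less_trans)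
      moreover have "(y ^ p) ^ N = 1" using less.prems(1) by (metis power_mult mult.commute power_one)
      moreover have "i < j" "i > 0" using i less.prems p prime_gt_1_nat by (auto)
      ultimately have "ieval h ((y ^ p) ^ i) = 0" using less i by auto
      then show ?thesis by (simp add: i power_mult)
    qed (use less in simp)
  qed
  \<comment> \<open>An exponent congruent to \<open>k\<close> modulo \<open>N\<close> with only large prime factors.\<close>
  define Q where "Q = \<Prod>{p. prime p \<and> p \<le> B \<and> \<not> p dvd k}"
  define j where "j = k + N * Q"
  have fin: "finite {p. prime p \<and> p \<le> B \<and> \<not> p dvd k}" by (rule finite_subset[of _ "{..B}"]) auto
  \<comment> \<open>A prime up to \<open>B\<close> divides exactly one of the summands
    \<open>k\<close> and \<open>N * Q\<close>: if it divides \<open>k\<close>, it divides neither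
    \<open>N\<close> nor \<open>Q\<close>; otherwise it is a factor of \<open>Q\<close>.\<close>
  have "p > B" if p: "prime p" "p dvd j" for p
  proof (rule ccontr)
    assume "\<not> p > B"
    show False
    proof (cases "p dvd k")
      case True
      then have "\<not> p dvd N" using k p by (meson coprime_common_divisor not_prime_unit)
      moreover have "\<not> p dvd Q"
      proof
        assume "p dvd Q"
        then obtain q where "prime q" "\<not> q dvd k" "p dvd q"
          unfolding Q_def using prime_dvd_prod_iff[OF fin p(1), of id] by auto
        then show False using True p primes_dvd_imp_eq by blast
      qed
      moreover have "p dvd N * Q" using True p by (simp add: j_def dvd_add_right_iff)
      ultimately show False using p prime_dvd_mult_iff by blast
    next
      case False
      then have "p dvd Q" unfolding Q_def using fin p \<open>\<not> p > B\<close> by (intro dvd_prodI[of _ _ id, simplified]) auto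
      then have "p dvd k" using p by (simp add: j_def dvd_add_left_iff)
      then show False using False by simp
    qed
  qed
  moreover have "Q > 0" unfolding Q_def by (intro prod_pos) (auto intro: prime_gt_0_nat)
  ultimately have "ieval h (z ^ j) = 0" using * h z N by (simp add: j_def)
  moreover have "z ^ j = z ^ k" using z by (simp add: j_def power_add power_mult)
  ultimately show ?thesis by simp
qed

subsection \<open>Critical values of rational polynomials\<close>

lemma reval_mult: "poly (cpoly (p * q)) z = poly (cpoly p) z * poly (cpoly q) z"
  by (rule poly_map_poly_mult) (auto simp: of_rat_add of_rat_mult)

lemma reval_add: "poly (cpoly (p + q)) z = poly (cpoly p) z + poly (cpoly q) z"
  by (rule poly_map_poly_add) (auto simp: of_rat_add)

lemma reval_smult: "poly (cpoly (smult c p)) z = of_rat c * poly (cpoly p) z"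
  by (rule poly_map_poly_smult) (auto simp: of_rat_mult)

lemma reval_power: "poly (cpoly (p ^ n)) z = poly (cpoly p) z ^ n"
  by (induction n) (auto simp: reval_mult)

lemma reval_sum: "poly (cpoly (sum f A)) z = (\<Sum>x\<in>A. poly (cpoly (f x)) z)"
  by (induction A rule: infinite_finite_induct) (auto simp: reval_add)

lemma reval_mod:
  assumes "poly (cpoly q) z = 0"
  shows "poly (cpoly (p mod q)) z = poly (cpoly p) z"
proof -
  have "poly (cpoly p) z = poly (cpoly (p div q * q + p mod q)) z" by simp
  then show ?thesis using assms by (simp only: reval_add reval_mult) simp
qed

lemma degree_cpoly [simp]: "degree (cpoly p) = degree p"
  by (rule degree_map_poly) auto

lemma pderiv_cpoly: "pderiv (cpoly p) = cpoly (pderiv p)"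
  by (rule poly_eqI) (simp add: coeff_pderiv coeff_map_poly of_rat_mult of_rat_add)

text \<open>Gaussian elimination on the top coefficient. Vanishing of coefficients instead of a
  degree bound lets the induction start at \<open>m = 0\<close>, and an indexed family allows
  repeated polynomials.\<close>

lemma polys_linearly_dependent:
  fixes g :: "'i \<Rightarrow> 'a::field poly"
  assumes "finite I" "card I > m" "\<And>i k. i \<in> I \<Longrightarrow> k \<ge> m \<Longrightarrow> coeff (g i) k = 0"
  shows "\<exists>c. (\<exists>i\<in>I. c i \<noteq> 0) \<and> (\<Sum>i\<in>I. smult (c i) (g i)) = 0"
  using assms
proof (induction m arbitrary: I g)
  case 0
  then have "g i = 0" if "i \<in> I" for i using that by (intro poly_eqI) auto
  moreover have "\<exists>i. i \<in> I" using 0 by (metis card.empty ex_in_conv less_irrefl)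
  ultimately show ?case by (intro exI[of _ "\<lambda>_. 1"]) auto
next
  case (Suc m)
  show ?case
  proof (cases "\<forall>i\<in>I. coeff (g i) m = 0")
    case True
    have "coeff (g i) k = 0" if "i \<in> I" "k \<ge> m" for i k
      using that True Suc.prems(3)[of i k] by (cases "k = m") auto
    then show ?thesis using Suc.IH[of I g] Suc.prems by auto
  next
    case False
    then obtain j where j: "j \<in> I" "coeff (g j) m \<noteq> 0" by auto
    define r where "r i = coeff (g i) m / coeff (g j) m" for i
    define g' where "g' i = g i - smult (r i) (g j)" for i
    have "\<exists>c. (\<exists>i\<in>I - {j}. c i \<noteq> 0) \<and> (\<Sum>i\<in>I - {j}. smult (c i) (g' i)) = 0"
    proof (rule Suc.IH)
      fix i k assume "i \<in> I - {j}" "k \<ge> m"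
      then show "coeff (g' i) k = 0"
        using j Suc.prems(3)[of i k] Suc.prems(3)[of j k] by (cases "k = m") (auto simp: g'_def r_def)
    qed (use Suc.prems j in auto)
    then obtain c i0 where c: "i0 \<in> I - {j}" "c i0 \<noteq> 0" "(\<Sum>i\<in>I - {j}. smult (c i) (g' i)) = 0"
      by auto
    \<comment> \<open>The coefficient of the pivot \<open>g j\<close> makes up for the multiples of
      it subtracted in \<open>g'\<close>.\<close>
    define c' where "c' i = (if i = j then - (\<Sum>i\<in>I - {j}. c i * r i) else c i)" for i
    have "(\<Sum>i\<in>I. smult (c' i) (g i)) = smult (c' j) (g j) + (\<Sum>i\<in>I - {j}. smult (c' i) (g i))"
      using Suc.prems j by (intro sum.remove) auto
    also have "(\<Sum>i\<in>I - {j}. smult (c' i) (g i)) = (\<Sum>i\<in>I - {j}. smult (c i) (g' i) + smult (c i * r i) (g j))"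
      by (intro sum.cong) (auto simp: c'_def g'_def smult_diff_right)
    also have "\<dots> = smult (\<Sum>i\<in>I - {j}. c i * r i) (g j)"
      using c by (simp add: sum.distrib smult_sum)
    finally have "(\<Sum>i\<in>I. smult (c' i) (g i)) = 0" by (simp add: c'_def)
    moreover have "c' i0 \<noteq> 0" "i0 \<in> I" using c by (auto simp: c'_def)
    ultimately show ?thesis by blast
  qed
qed

lemma common_denominator:
  fixes c :: "'i \<Rightarrow> rat"
  assumes "finite I"
  shows "\<exists>M a. M \<noteq> (0::int) \<and> (\<forall>i\<in>I. of_int M * c i = of_int (a i))"
  using assms
proof (induction I rule: finite_induct)
  case empty
  show ?case by (intro exI[of _ 1]) auto
next
  case (insert j I)
  then obtain M a where M: "M \<noteq> 0" "\<And>i. i \<in> I \<Longrightarrow> of_int M * c i = of_int (a i)" by blast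
  obtain x y where xy: "c j = of_int x / of_int y" "y > 0"
    by (metis quotient_of_denom_pos quotient_of_div surj_pair)
  have "of_int (M * y) * c i = of_int ((if i = j then M * x else a i * y))" if "i \<in> insert j I" for i
    using that M xy insert by (auto simp: field_simps)
  moreover have "M * y \<noteq> 0" using M xy by simp
  ultimately show ?case
    by (intro exI[of _ "M * y"] exI[of _ "\<lambda>i. if i = j then M * x else a i * y"] conjI ballI)
qed

lemma cis_add_inverse: "cis x + inverse (cis x) = of_real (2 * cos x)"
  by (simp add: complex_eq_iff)

text \<open>Multiplying the relation by the \<open>m\<close>-th power of
  \<open>cis (2 * pi * k / n)\<close> gives an integer polynomial \<open>h\<close> of degree at most
  \<open>2 * m\<close> with this root. The \<open>totient n\<close> primitive \<open>n\<close>-th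
  roots of unity are then all roots of \<open>h\<close>.\<close>

lemma totient_le_degree:
  fixes a :: "nat \<Rightarrow> int"
  assumes n: "n > 0" and k: "coprime k n"
    and a: "\<exists>i\<le>m. a i \<noteq> 0"
    and sum: "(\<Sum>i\<le>m. of_int (a i) * (of_real (2 * cos (2 * pi * real k / real n)) :: complex) ^ i) = 0"
  shows "totient n \<le> 2 * m"
proof -
  define e where "e i = cis (2 * pi * real i / real n)" for i
  \<comment> \<open>This is \<open>X ^ m * (X + 1 / X) ^ i\<close> with the denominators
    cleared.\<close>
  define t :: "nat \<Rightarrow> int poly" where "t i = [:1, 0, 1:] ^ i * monom 1 (m - i)" for i
  define h where "h = (\<Sum>i\<le>m. smult (a i) (t i))"
  have deg_t: "degree (t i) = m + i" if "i \<le> m" for i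
    using that by (simp add: t_def degree_mult_eq degree_power_eq degree_monom_eq)
  have lc_t: "lead_coeff (t i) = 1" for i
    by (simp add: t_def lead_coeff_mult lead_coeff_power degree_monom_eq)
  \<comment> \<open>The \<open>t i\<close> are monic of distinct degrees \<open>m + i\<close>, so
    the last nonzero \<open>a j\<close> survives as a coefficient of \<open>h\<close>.\<close>
  have "h \<noteq> 0"
  proof -
    define j where "j = Max {i. i \<le> m \<and> a i \<noteq> 0}"
    have fin: "finite {i. i \<le> m \<and> a i \<noteq> 0}" by (rule finite_subset[of _ "{..m}"]) auto
    have "j \<in> {i. i \<le> m \<and> a i \<noteq> 0}"
      unfolding j_def using a fin by (intro Max_in) auto
    then have j: "j \<le> m" "a j \<noteq> 0" by auto
    have jmax: "a i = 0" if "i \<le> m" "i > j" for i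
      using that Max_ge[OF fin, of i] by (auto simp flip: j_def)
    have "coeff h (m + j) = (\<Sum>i\<le>m. a i * coeff (t i) (m + j))"
      by (simp add: h_def coeff_sum)
    also have "\<dots> = (\<Sum>i\<in>{j}. a i * coeff (t i) (m + j))"
    proof (intro sum.mono_neutral_right ballI)
      fix i assume "i \<in> {..m} - {j}"
      then consider "i \<le> m" "i < j" | "i \<le> m" "i > j" by fastforce
      then show "a i * coeff (t i) (m + j) = 0"
        by cases (auto simp: jmax deg_t intro!: coeff_eq_0)
    qed (use j in auto)
    also have "\<dots> = a j" using lc_t[of j] j by (simp add: deg_t)
    finally show ?thesis using j by auto
  qed
  have deg_h: "degree h \<le> 2 * m"
    unfolding h_def by (intro degree_sum_le) (auto intro!: order.trans[OF degree_smult_le] simp: deg_t)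
  have h0: "ieval h (e k) = 0"
  proof -
    have "ieval (t i) (e k) = e k ^ m * (e k + inverse (e k)) ^ i" if "i \<le> m" for i
    proof -
      have "ieval (t i) (e k) = (e k ^ 2 + 1) ^ i * e k ^ (m - i)"
        by (simp add: t_def power2_eq_square add.commute)
      also have "e k ^ 2 + 1 = e k * (e k + inverse (e k))"
        by (simp add: distrib_left power2_eq_square e_def del: cis_inverse)
      also have "(e k * (e k + inverse (e k))) ^ i * e k ^ (m - i) 
          = e k ^ (i + (m - i)) * (e k + inverse (e k)) ^ i"
        by (simp add: power_mult_distrib power_add)
      finally show ?thesis using that by simp
    qed
    then have "ieval h (e k) = e k ^ m * (\<Sum>i\<le>m. of_int (a i) * (e k + inverse (e k)) ^ i)"
      by (simp add: h_def sum_distrib_left mult_ac)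
    then show ?thesis using sum unfolding e_def cis_add_inverse by simp
  qed
  have en: "e i ^ n = 1" for i
    using n by (simp add: e_def DeMoivre mult.commute[of "real n"]) 
  have inj: "inj_on (\<lambda>j. e k ^ j) (totatives n)"
  proof (rule inj_onI)
    fix i j assume ij: "i \<in> totatives n" "j \<in> totatives n" "e k ^ i = e k ^ j"
    have red: "e k ^ l = e (k * l mod n)" for l
    proof -
      have 1: "e 1 ^ i = e i" for i by (simp add: e_def DeMoivre mult_ac)
      have "e k ^ l = e 1 ^ (n * (k * l div n) + k * l mod n)"
        by (simp add: 1[of k, symmetric] power_mult[symmetric])
      also have "\<dots> = e 1 ^ (k * l mod n)" by (simp only: power_add power_mult en) simp
      finally show ?thesis by (simp only: 1)
    qed
    have "inj_on e {..<n}"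
      using bij_betw_roots_unity[OF n] unfolding bij_betw_def e_def[abs_def] by blast
    then have "k * i mod n = k * j mod n"
      using ij n unfolding red by (auto dest: inj_onD)
    then have "[k * i = k * j] (mod n)" by (simp add: cong_def)
    then have "[i = j] (mod n)" using k by (simp add: cong_mult_lcancel_nat)
    \<comment> \<open>Totatives lie in \<open>{0<..n}\<close>, so for \<open>n = 1\<close> the only
      one is 1, which is not below \<open>n\<close>.\<close>
    show "i = j"
    proof (cases "n = 1")
      case False
      then have "i < n" "j < n" using ij n totatives_less by auto
      then show ?thesis using \<open>[i = j] (mod n)\<close> by (simp add: cong_def)
    qed (use ij in auto)
  qed
  have "totient n = card ((\<lambda>j. e k ^ j) ` totatives n)"
    using card_image[OF inj] by (simp add: totient_def)
  also have "\<dots> \<le> card {x. ieval h x = 0}"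
  proof (rule card_mono)
    show "finite {x. ieval h x = 0}"
      using \<open>h \<noteq> 0\<close> by (intro poly_roots_finite) (auto simp: map_poly_eq_0_iff)
    show "(\<lambda>j. e k ^ j) ` totatives n \<subseteq> {x. ieval h x = 0}"
      using root_of_unity_conjugates[OF n en _ h0] by (auto simp: totatives_def)
  qed
  also have "\<dots> \<le> degree (map_poly of_int h :: complex poly)"
    using \<open>h \<noteq> 0\<close> by (intro card_poly_roots_bound) (auto simp: map_poly_eq_0_iff)
  also have "\<dots> = degree h" by (rule degree_map_poly) auto
  finally show ?thesis using deg_h by simp
qed

lemma totient_le_of_critical_value:
  fixes u :: "rat poly"
  assumes n: "n > 0" and k: "coprime k n" and deg: "degree u \<ge> 2"
    and u: "poly (cpoly u) z = of_real (cos (pi * (real k / real n)))"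
    and du: "poly (pderiv (cpoly u)) z = 0"
  shows "totient n \<le> 2 * (degree u - 1)"
proof -
  define m where "m = degree u - 1"
  \<comment> \<open>Doubling the angle gives a primitive \<open>n\<close>-th root of unity whatever the parity of \<open>k\<close>.\<close>
  define T where "T = smult 4 (u ^ 2) + [:-2:]"
  define g where "g i = T ^ i mod pderiv u" for i
  have m: "degree (pderiv u) = m" "m > 0" using deg by (auto simp: m_def degree_pderiv)
  \<comment> \<open>There are \<open>m + 1\<close> remainders modulo the derivative, which has
    degree \<open>m\<close>. Evaluation at its root \<open>z\<close> will undo the reduction and
    turn the dependence into a relation between powers of \<open>T\<close> at
    \<open>z\<close>.\<close>
  have "\<exists>c. (\<exists>i\<in>{..m}. c i \<noteq> 0) \<and> (\<Sum>i\<le>m. smult (c i) (g i)) = 0"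
  proof (rule polys_linearly_dependent)
    fix i k assume "k \<ge> m"
    moreover have "g i = 0 \<or> degree (g i) < m"
      unfolding g_def m(1)[symmetric] using m by (intro degree_mod_less) auto
    ultimately show "coeff (g i) k = 0" by (auto intro: coeff_eq_0)
  qed auto
  then obtain c where c: "\<exists>i\<le>m. c i \<noteq> 0" "(\<Sum>i\<le>m. smult (c i) (g i)) = 0" by auto
  obtain M a where M: "M \<noteq> (0::int)" "\<And>i. i \<le> m \<Longrightarrow> of_int M * c i = of_int (a i)"
    using common_denominator[of "{..m}" c] by auto
  have "poly (cpoly T) z = of_real (4 * cos (pi * (real k / real n)) ^ 2 - 2)"
    by (simp add: T_def reval_add reval_smult reval_power u map_poly_pCons)
  also have "4 * cos (pi * (real k / real n)) ^ 2 - 2 = 2 * cos (2 * (pi * (real k / real n)))"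
    by (simp only: cos_double_cos) simp
  also have "2 * (pi * (real k / real n)) = 2 * pi * real k / real n" by simp
  finally have T: "poly (cpoly T) z = of_real (2 * cos (2 * pi * real k / real n))" .
  have g: "poly (cpoly (g i)) z = of_real (2 * cos (2 * pi * real k / real n)) ^ i" for i
    unfolding g_def T[symmetric] reval_power[symmetric]
    by (rule reval_mod) (use du in \<open>simp add: pderiv_cpoly\<close>)
  have "(\<Sum>i\<le>m. of_rat (c i) * (of_real (2 * cos (2 * pi * real k / real n)) :: complex) ^ i) = 0"
    using arg_cong[OF c(2), of "\<lambda>p. poly (cpoly p) z"] by (simp only: reval_sum reval_smult g) simp
  then have "of_rat (of_int M) * (\<Sum>i\<le>m. of_rat (c i) * (of_real (2 * cos (2 * pi * real k / real n)) :: complex) ^ i) = 0"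
    by simp
  then have "(\<Sum>i\<le>m. of_rat (of_int M * c i) * (of_real (2 * cos (2 * pi * real k / real n)) :: complex) ^ i) = 0"
    by (simp only: sum_distrib_left of_rat_mult mult.assoc)
  then have "(\<Sum>i\<le>m. of_int (a i) * (of_real (2 * cos (2 * pi * real k / real n)) :: complex) ^ i) = 0"
    by (simp add: M)
  moreover have "\<exists>i\<le>m. a i \<noteq> 0"
    using c M by (metis mult_eq_0_iff of_int_0 of_int_eq_0_iff)
  ultimately show ?thesis
    unfolding m_def[symmetric] by (intro totient_le_degree[OF n k])
qed

subsection \<open>Repeated roots of the new parts\<close>

lemma cheb_root:
  assumes "n \<ge> 1" "poly (cheb n) c = 0"
  shows "\<exists>k\<in>{0<..<n}. c = of_real (cos (pi * (real k / real n)))"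
proof -
  obtain k where k: "k \<in> {0<..<n}" "poly (cheb_factor (real k / real n)) c = 0"
    using assms by (auto simp: cheb_eq_prod poly_prod)
  then have "c = of_real (cos (pi * (real k / real n)))" by (simp add: cheb_factor_def)
  then show ?thesis using k by blast
qed

text \<open>The cosine is injective on [0, pi], so only the \<open>k\<close>-th factor of
  \<open>cheb n\<close> vanishes at \<open>u(z)\<close>. The resulting order does not depend on
  \<open>n\<close>, which allows \<open>n\<close> to be compared with a proper divisor.\<close>

lemma order_pcompose_cheb:
  assumes k: "k \<in> {0<..<n}" and u: "poly u z = of_real (cos (pi * (real k / real n)))"
    and deg: "degree u > 0"
  shows "order z (pcompose (cheb n) u) = order z (u - [:poly u z:])"
proof -
  define f where "f j = cheb_factor (real j / real n)" for j
  define q where "q = (\<Prod>j\<in>{0<..<n} - {k}. f j)"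
  have n: "n \<ge> 1" using k by auto
  have "cheb n = f k * q"
    unfolding cheb_eq_prod[OF n] q_def f_def using k by (intro prod.remove) auto
  moreover have "pcompose (f k) u = smult 2 (u - [:poly u z:])"
    by (simp add: f_def cheb_factor_def u pcompose_pCons smult_diff_right numeral_poly)
  ultimately have eq: "pcompose (cheb n) u = smult 2 (u - [:poly u z:]) * pcompose q u"
    by (simp add: pcompose_mult)
  have "poly (f j) (poly u z) \<noteq> 0" if j: "j \<in> {0<..<n} - {k}" for j
  proof
    assume "poly (f j) (poly u z) = 0"
    then have "of_real (2 * cos (pi * (real k / real n))) = (of_real (2 * cos (pi * (real j / real n))) :: complex)"
      by (simp add: f_def cheb_factor_def u)
    then have "cos (pi * (real k / real n)) = cos (pi * (real j / real n))"
      unfolding of_real_eq_iff by simp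
    then have "pi * (real k / real n) = pi * (real j / real n)"
      by (rule cos_inj_pi[rotated -1]) (use j k in \<open>auto simp: field_simps\<close>)
    then show False using j k by auto
  qed
  then have q: "poly (pcompose q u) z \<noteq> 0"
    by (simp add: poly_pcompose q_def poly_prod)
  have "u - [:poly u z:] \<noteq> 0" using deg by (metis degree_pCons_0 eq_iff_diff_eq_0 less_irrefl)
  then have "order z (pcompose (cheb n) u) = order z (smult 2 (u - [:poly u z:])) + order z (pcompose q u)"
    unfolding eq using q by (intro order_mult) auto
  then show ?thesis using q by (simp add: order_0I order_smult)
qed

lemma pcompose_cheb_nonzero:
  assumes "degree u > 0" "n \<ge> 1"
  shows "pcompose (cheb n) u \<noteq> 0"
proof -
  have "cheb n \<noteq> 0" using cheb_degree[of "n - 1"] assms by auto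
  then show ?thesis using assms by (simp add: pcompose_eq_0_iff)
qed

text \<open>If \<open>k / n\<close> reduced to a denominator \<open>b < n\<close>, then
  \<open>cheb b\<close> and \<open>cheb n\<close> composed with \<open>u\<close> would have the same
  order at \<open>z\<close>. But the second is divisible by the first times \<open>w n\<close>,
  which adds at least 2 to the order.\<close>

lemma new_part_repeated_root:
  assumes sol: "pell_solution D u v" and v: "v \<noteq> 0" and deg: "degree u > 0"
    and w: "pell_new_parts D u v w" and n: "n \<ge> 2" and z: "order z (w n) \<ge> 2"
  shows "\<exists>k. coprime k n \<and> poly u z = of_real (cos (pi * (real k / real n))) \<and> poly (pderiv u) z = 0"
proof -
  \<comment> \<open>Since \<open>b < n\<close>, adding \<open>n\<close> to the divisors of
    \<open>b\<close> gives one more index and still only divisors of \<open>n\<close>; the common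
    factor \<open>v\<close> cancels.\<close>
  have dvd: "pcompose (cheb b) u * w n dvd pcompose (cheb n) u" if b: "b dvd n" "b < n" for b
  proof -
    have b0: "b \<ge> 1" using b n by (auto intro: Suc_leI Nat.gr0I)
    have "v * pcompose (cheb b) u * w n = (\<Prod>m\<in>insert n {m. m dvd b}. w m)"
      using w b b0 by (subst prod.insert) 
        (auto simp: pell_new_parts_def mult.commute dest: dvd_imp_le simp flip: pell_v_cheb[OF sol])
    also have "\<dots> dvd (\<Prod>m | m dvd n. w m)"
      using b n by (intro prod_dvd_prod_subset) (auto intro: dvd_trans)
    also have "\<dots> = v * pcompose (cheb n) u"
      using w n by (simp add: pell_new_parts_def flip: pell_v_cheb[OF sol])
    finally show ?thesis using v by (simp add: mult.assoc)
  qed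
  have nz: "pcompose (cheb n) u \<noteq> 0" using deg n by (intro pcompose_cheb_nonzero) auto
  have order: "order z (pcompose (cheb b) u) + 2 \<le> order z (pcompose (cheb n) u)"
    if b: "b dvd n" "b < n" for b
  proof -
    have "pcompose (cheb b) u * w n \<noteq> 0" using dvd[OF b] nz by auto
    then have "order z (pcompose (cheb b) u * w n) = order z (pcompose (cheb b) u) + order z (w n)"
      by (rule order_mult)
    then show ?thesis using dvd_imp_order_le[OF nz dvd[OF b], of z] z by simp
  qed
  \<comment> \<open>The divisor 1 is proper because \<open>n \<ge> 2\<close>, and
    \<open>cheb 1 = 1\<close> has order 0.\<close>
  have two: "order z (pcompose (cheb n) u) \<ge> 2" using order[of 1] n by simp
  then have "poly (cheb n) (poly u z) = 0"
    using order_root[of "pcompose (cheb n) u" z] by (simp add: poly_pcompose)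
  then obtain k where k: "k \<in> {0<..<n}" "poly u z = of_real (cos (pi * (real k / real n)))"
    using cheb_root[of n "poly u z"] n by auto
  have oz: "order z (pcompose (cheb n) u) = order z (u - [:poly u z:])"
    by (rule order_pcompose_cheb[OF k deg])
  have "coprime k n"
  proof (rule ccontr)
    assume "\<not> coprime k n"
    define g where "g = gcd k n"
    obtain k' b where kb: "k = g * k'" "n = g * b" unfolding g_def by (meson dvdE gcd_dvd1 gcd_dvd2)
    have "g > 1" using k \<open>\<not> coprime k n\<close> unfolding g_def 
      by (metis One_nat_def Suc_lessI coprime_iff_gcd_eq_1 gcd_pos_nat greaterThanLessThan_iff less_irrefl)
    then have "b < n" "k' \<in> {0<..<b}" and frac: "real k / real n = real k' / real b" using kb k n by auto
    then have "order z (pcompose (cheb b) u) = order z (u - [:poly u z:])"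
      using k(2) deg unfolding frac by (intro order_pcompose_cheb)
    moreover have "b dvd n" using kb by simp
    ultimately show False using order[OF _ \<open>b < n\<close>] oz by simp
  qed
  moreover have "poly (pderiv u) z = 0"
  proof -
    have nz': "u - [:poly u z:] \<noteq> 0" using deg by (metis degree_pCons_0 eq_iff_diff_eq_0 less_irrefl)
    have "order z (u - [:poly u z:]) = Suc (order z (pderiv (u - [:poly u z:])))"
      using nz' by (intro order_pderiv) auto
    then have "order z (pderiv u) \<noteq> 0" using two oz by (simp add: pderiv_diff pderiv_pCons)
    then show ?thesis by (simp add: order_root)
  qed
  ultimately show ?thesis using k by blast
qed

section \<open>Inverting the totient bound\<close>

theorem theorem2p5:
  shows "\<exists>C::real. C > 0 \<and> (\<exists>d0::nat. d0 \<ge> 3 \<and>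
    (\<forall>(D::rat poly) (u::rat poly) (v::rat poly) (w::nat \<Rightarrow> complex poly) (n::nat).
       degree D > 0 \<longrightarrow>
       pellian (cpoly D) \<longrightarrow>
       pell_fundamental (cpoly D) (cpoly u) (cpoly v) \<longrightarrow>
       degree u \<ge> d0 \<longrightarrow>
       pell_new_parts (cpoly D) (cpoly u) (cpoly v) w \<longrightarrow>
       n \<ge> 1 \<longrightarrow>
       (\<exists>z::complex. order z (w n) \<ge> 2) \<longrightarrow>
       real n \<le> C * real (degree u) * ln (ln (real (degree u)))))"
proof -
  \<comment> \<open>\<open>K\<close> combines the constant of the totient estimate with the 2 of
    \<open>totient n \<le> 2 * (d - 1)\<close>; \<open>B\<close> is the logarithm of the constant in
    the crude bound \<open>n \<le> 4 * K ^ 2 * d ^ 2\<close> derived below.\<close>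
  define K :: real where "K = 2 * exp 14"
  define B where "B = ln (4 * K ^ 2)"
  define C where "C = K * (2 + ln (B + 2))"
  have K: "K \<ge> 2" by (simp add: K_def)
  have "4 * K ^ 2 \<ge> 4 * 2 ^ 2" using K by (intro mult_left_mono power_mono) auto
  then have B: "B \<ge> 0" by (simp add: B_def)
  have "C \<ge> 2 * (2 + ln 2)" unfolding C_def using K B by (intro mult_mono) auto
  moreover have "2 * (2 + ln 2) \<ge> (2::real)" by simp
  ultimately have C: "C \<ge> 2" by (rule order.trans[rotated])
  have main: "real n \<le> C * real d * ln (ln (real d))"
    if d: "d \<ge> 256" and n: "n \<ge> 1" and tot: "n \<ge> 3 \<Longrightarrow> totient n \<le> 2 * (d - 1)" for n d
  proof -
    \<comment> \<open>The threshold 256 is \<open>2 ^ 8\<close>; with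
      \<open>ln 2 \<ge> 1 / 2\<close> it gives \<open>ln d \<ge> 4\<close>, hence
      \<open>ln (ln d) \<ge> 1\<close>, so that constants can be absorbed.\<close>
    have ld: "ln (real d) \<ge> 4"
    proof -
      have "4 \<le> 8 * ln (2::real)" using half_le_ln_2 by simp
      also have "\<dots> = ln (2 ^ 8)" by (simp only: ln_realpow of_nat_numeral)
      also have "\<dots> \<le> ln (real d)" using d by (subst ln_le_cancel_iff) auto
      finally show ?thesis .
    qed
    have lld: "ln (ln (real d)) \<ge> 1" using ld exp_le by (subst ln_ge_iff) auto
    show ?thesis
    proof (cases "n \<ge> 3")
      case False
      then have "real n \<le> 2 * 256 * 1" by simp
      also have "\<dots> \<le> C * real d * ln (ln (real d))"
        using C d lld by (intro mult_mono) auto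
      finally show ?thesis .
    next
      case True
      have ln_n: "ln (real n) \<ge> 1" using True exp_le by (subst ln_ge_iff) auto
      have "real n \<le> exp 14 * real (totient n) * (1 + ln (ln (real n)))"
        by (rule le_totient_ln_ln[OF True])
      also have "\<dots> \<le> exp 14 * (2 * real d) * (1 + ln (ln (real n)))"
        using tot[OF True] ln_n by (intro mult_right_mono mult_left_mono) auto
      finally have 1: "real n \<le> K * real d * (1 + ln (ln (real n)))" by (simp add: K_def mult_ac)
      \<comment> \<open>The bound still has \<open>n\<close> on its right side. A crude estimate by
        \<open>2 * sqrt n\<close> first makes \<open>n\<close> at most quadratic in
        \<open>d\<close>; fed back, this bounds \<open>ln (ln n)\<close> by \<open>ln (ln d)\<close>
        plus a constant.\<close>
      have "1 + ln (ln (real n)) \<le> ln (real n)"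
        using ln_le_minus_one[of "ln (real n)"] ln_n by linarith
      also have "\<dots> = 2 * ln (sqrt (real n))" using True by (simp add: ln_sqrt)
      also have "\<dots> \<le> 2 * sqrt (real n)"
        using ln_le_minus_one[of "sqrt (real n)"] True by simp
      finally have "K * real d * (1 + ln (ln (real n))) \<le> K * real d * (2 * sqrt (real n))"
        using K by (intro mult_left_mono) auto
      with 1 have "sqrt (real n) * sqrt (real n) \<le> (2 * K * real d) * sqrt (real n)" by (simp add: mult_ac)
      then have "sqrt (real n) \<le> 2 * K * real d" using True by (subst (asm) mult_le_cancel_right) auto
      then have "real n \<le> (2 * K * real d) ^ 2"
        by (simp add: real_le_lsqrt sqrt_le_D)
      also have "\<dots> = (4 * K ^ 2) * real d ^ 2" by (simp add: power_mult_distrib)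
      finally have "ln (real n) \<le> ln ((4 * K ^ 2) * real d ^ 2)"
        using True K d by (subst ln_le_cancel_iff) auto
      also have "\<dots> = B + 2 * ln (real d)" using K d by (subst ln_mult) (auto simp: B_def ln_realpow)
      also have "\<dots> \<le> (B + 2) * ln (real d)"
      proof -
        have "B * 1 \<le> B * ln (real d)" using B ld by (intro mult_left_mono) auto
        then show ?thesis by (simp add: algebra_simps)
      qed
      finally have "ln (ln (real n)) \<le> ln ((B + 2) * ln (real d))"
        using ln_n B ld by (subst ln_le_cancel_iff) auto
      also have "\<dots> = ln (B + 2) + ln (ln (real d))" using B ld by (subst ln_mult) auto
      finally have "1 + ln (ln (real n)) \<le> (1 + ln (B + 2)) * 1 + ln (ln (real d))" by simp
      also have "\<dots> \<le> (1 + ln (B + 2)) * ln (ln (real d)) + ln (ln (real d))"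
        using B lld by (intro add_mono mult_left_mono) auto
      also have "\<dots> = (2 + ln (B + 2)) * ln (ln (real d))" by (simp add: algebra_simps)
      finally have "K * real d * (1 + ln (ln (real n))) \<le> K * real d * ((2 + ln (B + 2)) * ln (ln (real d)))"
        using K by (intro mult_left_mono) auto
      with 1 show ?thesis by (simp add: C_def mult_ac)
    qed
  qed
  show ?thesis
  proof (intro exI[of _ C] exI[of _ 256] conjI allI impI)
    fix D u v :: "rat poly" and w and n :: nat
    assume fund: "pell_fundamental (cpoly D) (cpoly u) (cpoly v)" and deg: "degree u \<ge> 256"
      and w: "pell_new_parts (cpoly D) (cpoly u) (cpoly v) w" and n: "n \<ge> 1"
      and "\<exists>z. order z (w n) \<ge> 2"
    then obtain z where z: "order z (w n) \<ge> 2" by blast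
    have "totient n \<le> 2 * (degree u - 1)" if n3: "n \<ge> 3"
    proof -
      obtain k where "coprime k n" "poly (cpoly u) z = of_real (cos (pi * (real k / real n)))"
        "poly (pderiv (cpoly u)) z = 0"
        using new_part_repeated_root[of "cpoly D" "cpoly u" "cpoly v" w n z] fund deg w z n3
        by (auto simp: pell_fundamental_def)
      then show ?thesis using totient_le_of_critical_value[of n k u z] deg n by simp
    qed
    then show "real n \<le> C * real (degree u) * ln (ln (real (degree u)))"
      using main[OF deg n] by blast
  qed (use C in auto)
qed

end
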